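(* Assume that every $f\in\mathcal F$ is Lipschitz continuous with constant $L>0$, i.e. $|f(\mathbf x)-f(\mathbf y)|\le L\|\mathbf x-\mathbf y\|$ for all $\mathbf x,\mathbf y\in\mathsf X^n$; that every $f\in\mathcal F$ is differentiable with $\|\nabla f(\mathbf x)-\nabla f(\mathbf y)\|\le G\|\mathbf x-\mathbf y\|$ for all $\mathbf x,\mathbf y\in\mathsf X^n$; that $\sum_{i=1}^n r_i=1$ with $r_i>0$ for all $i$; and that $\sum_{j=1}^n M_{ij}=1$ for all $i$. Let $\alpha(t)=\frac1{\sqrt{t+1}}$ for all $t\ge 0$. Then, for every $T\ge1$, the algorithm ODA-C, run with local updates $u_i(t)=\langle\nabla f_t(\mathbf x_i(t)),\mathbf e_i\rangle$, $i=1,\dots,n$, $t\ge0$, and messages $v^k_{i\to j}(t)=z^k_i(t)$, has network regret satisfying $$R(T)\le nL^2\left(1+\frac{2}{r_*^{3/2}(1-\sqrt{1-\lambda})}\left(1+\frac{\sqrt n\,G D_{\mathsf X}}{L}\right)\right)\sqrt T+C\sqrt{T+1}.$$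
   Context: Setting. $\mathsf X\subset\mathbb R$ is a closed bounded interval, $D_{\mathsf X}=\sup_{x,y\in\mathsf X}|x-y|$; $\mathcal F$ is a class of convex functions $f:\mathsf X^n\to\mathbb R$; $\|\cdot\|$ is the Euclidean norm; $\mathbf e_1,\dots,\mathbf e_n$ is the standard basis of $\mathbb R^n$; $\delta_i^k$ is the Kronecker delta. The agents are $1,\dots,n$, joined by an undirected connected graph; $\mathcal N_i$ is the set of neighbors of $i$ together with $i$ itself. The function $f_t\in\mathcal F$ is arbitrary and may be chosen adaptively, depending on all data generated by the network up to time $t$. Costs are counted from round $t=1$; the function $f_0\in\mathcal F$ enters only through the local update at time $0$. Weights. $\mathbf r=(r_1,\dots,r_n)$ is a vector of positive weights, $r_*=\min_i r_i$, and $M$ is a nonnegative $n\times n$ matrix with $M_{ij}\ne0$ only if $j\in\mathcal N_i$ and $r_iM_{ij}=r_jM_{ji}$ for all $i,j$. With $\|\mathbf f\|_{\mathbf r}=\sqrt{\sum_i r_if_i^2}$, the spectral gap of $M$ is $$\lambda=\inf_{\mathbf f\in\mathbb R^n,\ \mathbf f\neq0,\ \langle\mathbf r,\mathbf f\rangle=0}\frac{\|\mathbf f\|_{\mathbf r}^2-\|M\mathbf f\|_{\mathbf r}^2}{\|\mathbf f\|_{\mathbf r}^2}$$ (put $\lambda=1$ if $n=1$). If $\lambda=0$ the right-hand side of the bound is read as $+\infty$. Proximal map. $\psi:\mathsf X^n\to[0,\infty)$ is continuous and 1-strongly convex with respect to $\|\cdot\|$, $C=\sup_{\mathbf x\in\mathsf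 X^n}|\psi(\mathbf x)|$, and $\Pi^\psi_{\mathsf X^n}(\mathbf z,\alpha)=\arg\min_{\mathbf x\in\mathsf X^n}\{\langle\mathbf z,\mathbf x\rangle+\frac1\alpha\psi(\mathbf x)\}$ for $\mathbf z\in\mathbb R^n$, $\alpha>0$. ODA-C. Each agent $i$ maintains $\mathbf z_i(t)=(z_i^1(t),\dots,z_i^n(t))\in\mathbb R^n$ with $\mathbf z_i(0)=0$ and $\mathbf x_i(t)=(x_i^1(t),\dots,x_i^n(t))\in\mathsf X^n$ (with no condition imposed on $\mathbf x_i(0)\in\mathsf X^n$), updated for $t\ge0$ by $$z_i^k(t+1)=\tfrac1{r_i}\delta_i^ku_i(t)+z_i^k(t)+\sum_{j=1}^nM_{ij}\big(v^k_{j\to i}(t)-v^k_{i\to j}(t)\big),\quad k=1,\dots,n,$$ $$\mathbf x_i(t+1)=\Pi^\psi_{\mathsf X^n}(\mathbf z_i(t+1),\alpha(t)).$$ Regret. The network action at time $t$ is $\mathbf x(t)=(x_1^1(t),x_2^2(t),\dots,x_n^n(t))$ (agent $i$ plays the $i$th coordinate of $\mathbf x_i(t)$), and $R(T)=\sum_{t=1}^Tf_t(\mathbf x(t))-\inf_{\mathbf y\in\mathsf X^n}\sum_{t=1}^Tf_t(\mathbf y)$. *)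

theory Defs
  imports "HOL-Analysis.Analysis"
begin

text \<open>Agents are the elements of a finite type \<open>'n\<close>, so that \<open>n = CARD('n)\<close>.
  Functions on \<open>X\<^sup>n\<close> are total functions on \<open>real ^ 'n\<close>; everything below uses only
  their values on \<open>X\<^sup>n\<close>.\<close>

definition cube :: "real set \<Rightarrow> (real ^ 'n) set" where
  "cube X = {x. \<forall>i. x $ i \<in> X}"

text \<open>The gradient is taken within \<open>S\<close>, since the functions are given on \<open>S = X\<^sup>n\<close> only.
  On a box with nonempty interior it is unique, and at interior points it is the vector \<open>D\<close>
  with \<open>GDERIV f x :> D\<close>.\<close>

definition gradient_within ::
  "('a::real_inner \<Rightarrow> real) \<Rightarrow> 'a set \<Rightarrow> 'a \<Rightarrow> 'a" where
  "gradient_within f S x = (SOME D. (f has_derivative (\<lambda>h. h \<bullet> D)) (at x within S))"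

definition strongly_convex_on ::
  "real \<Rightarrow> 'a::real_normed_vector set \<Rightarrow> ('a \<Rightarrow> real) \<Rightarrow> bool" where
  "strongly_convex_on m S f \<longleftrightarrow> convex S \<and>
     (\<forall>x\<in>S. \<forall>y\<in>S. \<forall>t\<in>{0..1}.
        f (t *\<^sub>R x + (1 - t) *\<^sub>R y)
          \<le> t * f x + (1 - t) * f y - m / 2 * t * (1 - t) * (norm (x - y))\<^sup>2)"

text \<open>An undirected graph on the vertex set \<open>'n\<close> is a symmetric relation; loops are
  irrelevant because \<open>\<N>\<^sub>i\<close> contains \<open>i\<close> anyway.\<close>

definition connected_graph :: "('n \<Rightarrow> 'n \<Rightarrow> bool) \<Rightarrow> bool" where
  "connected_graph E \<longleftrightarrow> symp E \<and> (\<forall>i j. E\<^sup>*\<^sup>* i j)"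

definition closed_nbhd :: "('n \<Rightarrow> 'n \<Rightarrow> bool) \<Rightarrow> 'n \<Rightarrow> 'n set" where
  "closed_nbhd E i = insert i {j. E i j}"

definition wnorm :: "real ^ 'n \<Rightarrow> real ^ 'n \<Rightarrow> real" where
  "wnorm r f = sqrt (\<Sum>i\<in>UNIV. r $ i * (f $ i)\<^sup>2)"

text \<open>For \<open>n = 1\<close> and \<open>r > 0\<close> the infimum would range over the empty set.\<close>

definition spectral_gap :: "real ^ 'n \<Rightarrow> real ^ 'n ^ 'n \<Rightarrow> real" where
  "spectral_gap r M =
     (if CARD('n) = 1 then 1
      else (INF f\<in>{f. f \<noteq> 0 \<and> r \<bullet> f = 0}.
              ((wnorm r f)\<^sup>2 - (wnorm r (M *v f))\<^sup>2) / (wnorm r f)\<^sup>2))"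

definition prox ::
  "(real ^ 'n) set \<Rightarrow> (real ^ 'n \<Rightarrow> real) \<Rightarrow> real ^ 'n \<Rightarrow> real \<Rightarrow> real ^ 'n" where
  "prox S \<psi> z \<alpha> = arg_min_on (\<lambda>x. z \<bullet> x + 1 / \<alpha> * \<psi> x) S"

text \<open>A run of the algorithm, as a relation between the sequences it generates:
  \<open>u i t\<close> is the local update of agent \<open>i\<close> at time \<open>t\<close>, \<open>v i j t $ k\<close> is the
  message \<open>v\<^sup>k\<close> from \<open>i\<close> to \<open>j\<close>, and \<open>z i t\<close>, \<open>x i t\<close> are the vectors maintained by
  agent \<open>i\<close>. Nothing is assumed about how the cost functions entering through \<open>u\<close> arise,
  so a statement about all runs covers cost functions chosen adaptively.\<close>

definition oda_c_run ::
  "(real ^ 'n) set \<Rightarrow> (real ^ 'n \<Rightarrow> real) \<Rightarrow> real ^ 'n \<Rightarrow> real ^ 'n ^ 'n \<Rightarrow> (nat \<Rightarrow> real) \<Rightarrow>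
   ('n \<Rightarrow> nat \<Rightarrow> real) \<Rightarrow> ('n \<Rightarrow> 'n \<Rightarrow> nat \<Rightarrow> real ^ 'n) \<Rightarrow>
   ('n \<Rightarrow> nat \<Rightarrow> real ^ 'n) \<Rightarrow> ('n \<Rightarrow> nat \<Rightarrow> real ^ 'n) \<Rightarrow> bool" where
  "oda_c_run S \<psi> r M \<alpha> u v z x \<longleftrightarrow>
     (\<forall>i. z i 0 = 0) \<and>
     (\<forall>i. x i 0 \<in> S) \<and>
     (\<forall>t i k. z i (t + 1) $ k =
        1 / r $ i * of_bool (i = k) * u i t + z i t $ k
        + (\<Sum>j\<in>UNIV. M $ i $ j * (v j i t $ k - v i j t $ k))) \<and>
     (\<forall>t i. x i (t + 1) = prox S \<psi> (z i (t + 1)) (\<alpha> t))"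

definition network_action :: "('n \<Rightarrow> nat \<Rightarrow> real ^ 'n) \<Rightarrow> nat \<Rightarrow> real ^ 'n" where
  "network_action x t = (\<chi> i. x i t $ i)"

definition regret ::
  "'a set \<Rightarrow> (nat \<Rightarrow> 'a \<Rightarrow> real) \<Rightarrow> (nat \<Rightarrow> 'a) \<Rightarrow> nat \<Rightarrow> real" where
  "regret S f a T = (\<Sum>t=1..T. f t (a t)) - (INF y\<in>S. \<Sum>t=1..T. f t y)"

end

theory Submission
  imports Defs
begin

text \<open>Write \<open>u(t) = (u\<^sub>1(t), \<dots>, u\<^sub>n(t))\<close>. The iterates \<open>x\<^sub>i(t)\<close> are compared with dual averaging
  run centrally on \<open>u(1), u(2), \<dots>\<close>, that is, with
  \<open>q(t) = \<Pi>(\<Sum>s=1..<t. u(s), 1/\<surd>t)\<close>. Since \<open>u(0)\<close> is left out, the regret of \<open>q\<close> on the linear costs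
  \<open>u(t)\<close>, \<open>t \<ge> 1\<close>, is at most \<open>n L\<^sup>2 \<surd>T + C \<surd>(T+1)\<close> with no extra term coming from round \<open>0\<close>.
  The price is that the \<open>k\<close>-th coordinate of \<open>z\<^sub>i(t) - (\<Sum>s=1..<t. u(s))\<close>, as a vector
  indexed by \<open>i\<close>, has \<open>r\<close>-weighted mean \<open>u\<^sub>k(0)\<close> instead of \<open>0\<close>. As \<open>e\<^sub>k/r\<^sub>k - 1\<close>
  has squared weighted norm \<open>1/r\<^sub>k - 1\<close>, the constant component \<open>u\<^sub>k(0)\<close>, which is orthogonal to the rest, fits into the
  same bound \<open>L / (\<surd>r\<^sub>k (1 - \<surd>(1 - \<lambda>)))\<close>. The proximal map with parameter \<open>\<alpha>\<close> is
  \<open>\<alpha>\<close>-Lipschitz, so \<open>x\<^sub>i(t) - q(t)\<close> is of order \<open>1/\<surd>t\<close>; Lipschitz continuity and smoothness of the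
  costs turn this into regret.\<close>

section \<open>The weighted norm and the spectral gap\<close>

text \<open>Rescaling coordinate \<open>i\<close> by \<open>sqrt (r $ i)\<close> lets the triangle
  inequality and homogeneity be inherited from the Euclidean norm.\<close>

lemma wnorm_eq_norm:
  assumes "\<And>i. r $ i \<ge> 0"
  shows "wnorm r f = norm (\<chi> i. sqrt (r $ i) * f $ i)"
  using assms by (simp add: wnorm_def norm_vec_def L2_set_def power_mult_distrib)

lemma wnorm_power2:
  assumes "\<And>i. r $ i \<ge> 0"
  shows "(wnorm r f)\<^sup>2 = (\<Sum>i\<in>UNIV. r $ i * (f $ i)\<^sup>2)"
  unfolding wnorm_def using assms by (intro real_sqrt_pow2 sum_nonneg) simp

lemma wnorm_nonneg: "\<lbrakk>\<And>i. r $ i \<ge> 0\<rbrakk> \<Longrightarrow> wnorm r f \<ge> 0"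
  by (simp add: wnorm_eq_norm)

lemma wnorm_pos:
  assumes "\<And>i. r $ i > 0" "f \<noteq> 0"
  shows "wnorm r f > 0"
proof -
  obtain i where "f $ i \<noteq> 0"
    using assms(2) by (auto simp: vec_eq_iff)
  then have "(\<Sum>i\<in>UNIV. r $ i * (f $ i)\<^sup>2) > 0"
    by (intro sum_pos2[of UNIV i]) (auto simp: assms(1) less_imp_le)
  then show ?thesis
    by (simp add: wnorm_def)
qed

lemma wnorm_triangle:
  assumes "\<And>i. r $ i \<ge> 0"
  shows "wnorm r (f + g) \<le> wnorm r f + wnorm r g"
proof -
  have "(\<chi> i. sqrt (r $ i) * (f + g) $ i) = (\<chi> i. sqrt (r $ i) * f $ i) + (\<chi> i. sqrt (r $ i) * g $ i)"
    by (simp add: vec_eq_iff distrib_left)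
  then show ?thesis
    unfolding wnorm_eq_norm[OF assms] by (metis norm_triangle_ineq)
qed

lemma wnorm_scaleR:
  assumes "\<And>i. r $ i \<ge> 0"
  shows "wnorm r (c *\<^sub>R f) = \<bar>c\<bar> * wnorm r f"
proof -
  have "(\<chi> i. sqrt (r $ i) * (c *\<^sub>R f) $ i) = c *\<^sub>R (\<chi> i. sqrt (r $ i) * f $ i)"
    by (simp add: vec_eq_iff)
  then show ?thesis
    unfolding wnorm_eq_norm[OF assms] by (metis norm_scaleR)
qed

text \<open>Jensen's inequality for the square: the difference of the two sides is the variance of
  \<open>x\<close> under \<open>p\<close>.\<close>

lemma weighted_sum_power2_le:
  fixes p x :: "'i \<Rightarrow> real"
  assumes "\<And>i. i \<in> I \<Longrightarrow> p i \<ge> 0" "sum p I = 1"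
  shows "(\<Sum>i\<in>I. p i * x i)\<^sup>2 \<le> (\<Sum>i\<in>I. p i * (x i)\<^sup>2)"
proof -
  define m where "m = (\<Sum>i\<in>I. p i * x i)"
  have "0 \<le> (\<Sum>i\<in>I. p i * (x i - m)\<^sup>2)"
    using assms by (intro sum_nonneg) auto
  also have "\<dots> = (\<Sum>i\<in>I. p i * (x i)\<^sup>2 - 2 * m * (p i * x i) + m\<^sup>2 * p i)"
    by (intro sum.cong refl) (simp add: power2_eq_square algebra_simps)
  also have "\<dots> = (\<Sum>i\<in>I. p i * (x i)\<^sup>2) - 2 * m * m + m\<^sup>2"
    by (simp add: sum.distrib sum_subtractf sum_distrib_left[symmetric] m_def assms(2))
  finally show ?thesis
    by (simp add: m_def power2_eq_square)
qed

text \<open>Each row of \<open>M\<close> is a probability vector, so Jensen applies row by row.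
  Symmetry with respect to \<open>r\<close> then turns column sums into row sums, which are
  1.\<close>

lemma wnorm_matrix_le:
  assumes r: "\<And>i. r $ i \<ge> 0" and M_nonneg: "\<And>i j. M $ i $ j \<ge> 0"
    and M_sym: "\<And>i j. r $ i * M $ i $ j = r $ j * M $ j $ i"
    and M_sum: "\<And>i. (\<Sum>j\<in>UNIV. M $ i $ j) = 1"
  shows "(wnorm r (M *v f))\<^sup>2 \<le> (wnorm r f)\<^sup>2"
proof -
  have "(wnorm r (M *v f))\<^sup>2 \<le> (\<Sum>i\<in>UNIV. r $ i * (\<Sum>j\<in>UNIV. M $ i $ j * (f $ j)\<^sup>2))"
    unfolding wnorm_power2[OF r] matrix_vector_mult_def
    by (auto intro!: sum_mono mult_left_mono weighted_sum_power2_le simp: M_nonneg M_sum r)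
  also have "\<dots> = (\<Sum>j\<in>UNIV. \<Sum>i\<in>UNIV. (r $ i * M $ i $ j) * (f $ j)\<^sup>2)"
    by (subst sum.swap) (simp add: sum_distrib_left mult.assoc)
  also have "\<dots> = (\<Sum>j\<in>UNIV. r $ j * (f $ j)\<^sup>2 * (\<Sum>i\<in>UNIV. M $ j $ i))"
    by (subst M_sym) (simp add: sum_distrib_left sum_distrib_right mult_ac)
  finally show ?thesis
    by (simp add: M_sum wnorm_power2[OF r])
qed

text \<open>Makes the set in the infimum of \<open>spectral_gap\<close> nonempty; a combination of
  two distinct axes suffices.\<close>

lemma exists_orthogonal_vec:
  fixes r :: "real ^ 'n"
  assumes "CARD('n) \<noteq> 1" and r: "\<And>i. r $ i > 0"
  shows "\<exists>f. f \<noteq> 0 \<and> r \<bullet> f = 0"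
proof -
  obtain i j :: 'n where "i \<noteq> j"
    using assms(1) by (auto simp: card_1_singleton_iff) (metis UNIV_eq_I insertI1 singletonI)
  then have "(axis i (r $ j) - axis j (r $ i)) $ i \<noteq> 0"
    using r[of j] by (simp add: axis_def)
  moreover have "r \<bullet> (axis i (r $ j) - axis j (r $ i)) = 0"
    by (simp add: inner_diff_right inner_axis)
  ultimately show ?thesis
    by (metis zero_index)
qed

text \<open>That \<open>M\<close> does not increase the weighted norm makes every quotient
  nonnegative, so the real infimum is meaningful. The contraction is the defining quotient
  rearranged; its square root appears because the quotient compares squared norms.\<close>

lemma spectral_gap_bounds:
  fixes r :: "real ^ 'n" and M :: "real ^ 'n ^ 'n"
  assumes r: "\<And>i. r $ i > 0" and M_nonneg: "\<And>i j. M $ i $ j \<ge> 0"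
    and M_sym: "\<And>i j. r $ i * M $ i $ j = r $ j * M $ j $ i"
    and M_sum: "\<And>i. (\<Sum>j\<in>UNIV. M $ i $ j) = 1"
  shows spectral_gap_nonneg: "spectral_gap r M \<ge> 0"
    and spectral_gap_le_1: "spectral_gap r M \<le> 1"
    and wnorm_matrix_le_spectral_gap:
      "r \<bullet> f = 0 \<Longrightarrow> wnorm r (M *v f) \<le> sqrt (1 - spectral_gap r M) * wnorm r f"
proof -
  have r': "r $ i \<ge> 0" for i
    using r[of i] by simp
  let ?A = "{f. f \<noteq> 0 \<and> r \<bullet> f = 0}"
  let ?q = "\<lambda>f. ((wnorm r f)\<^sup>2 - (wnorm r (M *v f))\<^sup>2) / (wnorm r f)\<^sup>2"
  have q_nonneg: "?q f \<ge> 0" for f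
    using wnorm_matrix_le[OF r' M_nonneg M_sym M_sum, of f] by simp
  then have bdd: "bdd_below (?q ` ?A)"
    by (intro bdd_belowI[of _ 0]) auto
  have q_le: "?q f \<le> 1" if "f \<noteq> 0" for f
    using wnorm_pos[OF r that] by (simp add: divide_simps)
  have "0 \<le> spectral_gap r M \<and> spectral_gap r M \<le> 1"
  proof (cases "CARD('n) = 1")
    case False
    then obtain f where f: "f \<in> ?A"
      using exists_orthogonal_vec[OF _ r] by blast
    have "0 \<le> (INF f\<in>?A. ?q f)"
      using f by (intro cINF_greatest q_nonneg) auto
    moreover have "(INF f\<in>?A. ?q f) \<le> 1"
      using cINF_lower[OF bdd f] q_le[of f] f by simp
    ultimately show ?thesis
      using False by (simp add: spectral_gap_def)
  qed (simp add: spectral_gap_def)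
  then show g0: "spectral_gap r M \<ge> 0" and g1: "spectral_gap r M \<le> 1"
    by auto
  show "wnorm r (M *v f) \<le> sqrt (1 - spectral_gap r M) * wnorm r f" if f: "r \<bullet> f = 0"
  proof (cases "f = 0")
    case True
    then show ?thesis by (simp add: wnorm_def)
  next
    case False
    \<comment> \<open>With a single agent, orthogonality to \<open>r\<close> forces
      \<open>f = 0\<close>, so the conventional value 1 of the gap cannot occur here.\<close>
    have "CARD('n) \<noteq> 1"
    proof
      assume "CARD('n) = 1"
      then obtain i where "(UNIV :: 'n set) = {i}"
        by (auto simp: card_1_singleton_iff)
      note i = this
      have "f $ i = 0"
        using f r[of i] by (simp add: inner_vec_def i)
      moreover have "j = i" for j
        using i by blast
      ultimately have "f = 0"
        by (metis vec_eq_iff zero_index)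
      with False show False by simp
    qed
    then have "spectral_gap r M \<le> ?q f"
      using cINF_lower[OF bdd, of f] f False by (simp add: spectral_gap_def)
    then have "(wnorm r (M *v f))\<^sup>2 \<le> (1 - spectral_gap r M) * (wnorm r f)\<^sup>2"
      using wnorm_pos[OF r False] by (simp add: field_simps)
    then have "sqrt ((wnorm r (M *v f))\<^sup>2) \<le> sqrt ((1 - spectral_gap r M) * (wnorm r f)\<^sup>2)"
      by (rule real_sqrt_le_mono)
    then show ?thesis
      by (simp add: real_sqrt_mult wnorm_nonneg r')
  qed
qed

section \<open>Consensus error of one coordinate\<close>

text \<open>\<open>Z\<close> collects one coordinate of the dual vectors of all agents, and only
  agent \<open>k\<close> injects into it. Deviations from the weighted mean are contracted by
  \<open>M\<close> and fed by bounded injections, so they stay below a geometric series.\<close>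

lemma wnorm_consensus_le:
  fixes r :: "real ^ 'n" and M :: "real ^ 'n ^ 'n" and U :: "nat \<Rightarrow> real" and Z :: "nat \<Rightarrow> real ^ 'n"
  assumes r: "\<And>i. r $ i > 0" "(\<Sum>i\<in>UNIV. r $ i) = 1"
    and M_nonneg: "\<And>i j. M $ i $ j \<ge> 0"
    and M_sym: "\<And>i j. r $ i * M $ i $ j = r $ j * M $ j $ i"
    and M_sum: "\<And>i. (\<Sum>j\<in>UNIV. M $ i $ j) = 1"
    and gap: "spectral_gap r M > 0"
    and U: "\<And>t. \<bar>U t\<bar> \<le> L"
    and Z: "Z 0 = 0" "\<And>t. Z (Suc t) = M *v Z t + (U t / r $ k) *\<^sub>R axis k 1"
  shows "(wnorm r (Z (Suc t) - (\<Sum>s=1..t. U s) *\<^sub>R 1))\<^sup>2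
    \<le> L\<^sup>2 / (r $ k * (1 - sqrt (1 - spectral_gap r M))\<^sup>2)"
proof -
  have r': "r $ i \<ge> 0" for i
    using r(1)[of i] by simp
  define \<sigma> where "\<sigma> = sqrt (1 - spectral_gap r M)"
  note sgb = spectral_gap_bounds[OF r(1) M_nonneg M_sym M_sum]
  have \<sigma>: "0 \<le> \<sigma>" "\<sigma> < 1"
    using sgb(2) gap by (auto simp: \<sigma>_def)
  have L: "L \<ge> 0"
    using U[of 0] by linarith
  define m where "m t = (\<Sum>s<t. U s)" for t
  define d where "d t = Z t - m t *\<^sub>R 1" for t
  \<comment> \<open>The injected direction less its weighted mean, so that the recursion for
    \<open>d\<close> stays in the subspace on which \<open>M\<close> contracts.\<close>
  define e where "e = (1 / r $ k) *\<^sub>R axis k 1 - (1 :: real ^ 'n)"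
  have r1: "r \<bullet> 1 = 1"
    by (simp add: inner_vec_def r(2))
  have re: "r \<bullet> e = 0"
    using r(1)[of k] by (simp add: e_def inner_diff_right r1 inner_axis)
  have M1: "M *v 1 = 1"
    by (simp add: vec_eq_iff matrix_vector_mult_def M_sum)
  \<comment> \<open>By symmetry the \<open>r\<close>-weighted sum of column \<open>j\<close> is
    \<open>r $ j\<close>, so averaging preserves the weighted mean.\<close>
  have rM: "r \<bullet> (M *v f) = r \<bullet> f" for f
  proof -
    have "r \<bullet> (M *v f) = (\<Sum>j\<in>UNIV. \<Sum>i\<in>UNIV. (r $ i * M $ i $ j) * f $ j)"
      by (subst sum.swap) (simp add: inner_vec_def matrix_vector_mult_def sum_distrib_left mult.assoc)
    also have "\<dots> = (\<Sum>j\<in>UNIV. r $ j * f $ j * (\<Sum>i\<in>UNIV. M $ j $ i))"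
      by (subst M_sym) (simp add: sum_distrib_left sum_distrib_right mult_ac)
    finally show ?thesis
      by (simp add: M_sum inner_vec_def)
  qed
  have d_Suc: "d (Suc t) = M *v d t + U t *\<^sub>R e" for t
    by (simp add: d_def m_def Z e_def matrix_vector_mult_diff_distrib matrix_vector_mult_scaleR M1
        scaleR_left_distrib scaleR_right_diff_distrib)
  have rd: "r \<bullet> d t = 0" for t
  proof (induction t)
    case 0
    then show ?case by (simp add: d_def m_def Z)
  next
    case (Suc t)
    then show ?case by (simp add: d_Suc inner_add_right rM re)
  qed
  \<comment> \<open>For \<open>f\<close> orthogonal to \<open>r\<close> the cross term vanishes.
    This gives the exact norm of \<open>e\<close> and later adds back \<open>U 0\<close> without
    loss.\<close>
  have pyth: "(wnorm r (f + c *\<^sub>R 1))\<^sup>2 = (wnorm r f)\<^sup>2 + 2 * c * (r \<bullet> f) + c\<^sup>2" for f c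
  proof -
    have "(wnorm r (f + c *\<^sub>R 1))\<^sup>2 = (\<Sum>i\<in>UNIV. r $ i * (f $ i)\<^sup>2 + 2 * c * (r $ i * f $ i) + c\<^sup>2 * r $ i)"
      unfolding wnorm_power2[OF r'] by (intro sum.cong refl) (simp add: power2_eq_square algebra_simps)
    also have "\<dots> = (wnorm r f)\<^sup>2 + 2 * c * (r \<bullet> f) + c\<^sup>2"
      by (simp add: sum.distrib sum_distrib_left[symmetric] r(2) wnorm_power2[OF r'] inner_vec_def)
    finally show ?thesis .
  qed
  have e2: "(wnorm r e)\<^sup>2 = 1 / r $ k - 1"
  proof -
    have *: "(wnorm r ((1 / r $ k) *\<^sub>R axis k 1))\<^sup>2 = 1 / r $ k"
      unfolding wnorm_power2[OF r'] using r(1)[of k]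
      by (subst sum.remove[of _ k]) (auto simp: axis_def power2_eq_square)
    have "(wnorm r e)\<^sup>2 = (wnorm r ((1 / r $ k) *\<^sub>R axis k 1 + (-1) *\<^sub>R 1))\<^sup>2"
      by (simp add: e_def)
    also have "\<dots> = 1 / r $ k + 2 * (-1) * (r \<bullet> ((1 / r $ k) *\<^sub>R axis k 1)) + (-1)\<^sup>2"
      unfolding pyth * ..
    also have "\<dots> = 1 / r $ k - 1"
      using r(1)[of k] by (simp add: inner_axis)
    finally show ?thesis .
  qed
  \<comment> \<open>The bound is the fixed point of the map from \<open>s\<close> to
    \<open>\<sigma> * s + L * wnorm r e\<close>.\<close>
  have d_le: "wnorm r (d t) \<le> L * wnorm r e / (1 - \<sigma>)" for t
  proof (induction t)
    case 0
    have "wnorm r (d 0) = 0"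
      by (simp add: d_def m_def Z wnorm_def)
    then show ?case using \<sigma> L wnorm_nonneg[OF r', of e] by simp
  next
    case (Suc t)
    have "wnorm r (d (Suc t)) \<le> wnorm r (M *v d t) + wnorm r (U t *\<^sub>R e)"
      unfolding d_Suc by (rule wnorm_triangle[OF r'])
    also have "\<dots> \<le> \<sigma> * wnorm r (d t) + L * wnorm r e"
      unfolding \<sigma>_def wnorm_scaleR[OF r']
      by (intro add_mono sgb(3) rd mult_right_mono U wnorm_nonneg r')
    also have "\<dots> \<le> \<sigma> * (L * wnorm r e / (1 - \<sigma>)) + L * wnorm r e"
      using Suc \<sigma> by (intro add_right_mono mult_left_mono) auto
    also have "\<dots> = L * wnorm r e / (1 - \<sigma>)"
      using \<sigma> by (simp add: field_simps)
    finally show ?case .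
  qed
  \<comment> \<open>\<open>m (Suc t)\<close> counts rounds 0 to \<open>t\<close>, the comparison sum
    only rounds 1 to \<open>t\<close>; the constant \<open>U 0\<close> is left over.\<close>
  have eq: "Z (Suc t) - (\<Sum>s=1..t. U s) *\<^sub>R 1 = d (Suc t) + U 0 *\<^sub>R 1"
  proof -
    have "m (Suc t) = U 0 + (\<Sum>s=1..t. U s)"
      unfolding m_def by (simp add: lessThan_Suc_atMost atMost_atLeast0 sum.atLeast_Suc_atMost)
    then show ?thesis
      by (simp add: d_def algebra_simps)
  qed
  have "(wnorm r (Z (Suc t) - (\<Sum>s=1..t. U s) *\<^sub>R 1))\<^sup>2 = (wnorm r (d (Suc t)))\<^sup>2 + (U 0)\<^sup>2"
    unfolding eq pyth rd by simp
  also have "\<dots> \<le> (L * wnorm r e / (1 - \<sigma>))\<^sup>2 + L\<^sup>2"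
    using add_mono[OF power_mono[OF d_le[of "Suc t"] wnorm_nonneg[OF r'], of 2] power_mono[OF U[of 0] abs_ge_zero, of 2]]
    by (simp only: power2_abs)
  \<comment> \<open>With a common denominator, the leftover 1 cancels the -1 in the squared norm
    \<open>1 / r $ k - 1\<close> of \<open>e\<close>.\<close>
  also have "\<dots> \<le> (L * wnorm r e / (1 - \<sigma>))\<^sup>2 + L\<^sup>2 / (1 - \<sigma>)\<^sup>2"
  proof -
    have "(1 - \<sigma>)\<^sup>2 \<le> 1" "(1 - \<sigma>)\<^sup>2 > 0"
      using \<sigma> by (auto intro!: power_le_one)
    then have "L\<^sup>2 * (1 - \<sigma>)\<^sup>2 \<le> L\<^sup>2"
      by (intro mult_right_le_one_le) auto
    then show ?thesis
      using \<open>(1 - \<sigma>)\<^sup>2 > 0\<close> by (simp only: pos_le_divide_eq add_le_cancel_left)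
  qed
  also have "\<dots> = L\<^sup>2 * ((wnorm r e)\<^sup>2 + 1) / (1 - \<sigma>)\<^sup>2"
    by (simp add: power_mult_distrib power_divide add_divide_distrib distrib_left)
  also have "\<dots> = L\<^sup>2 / (r $ k * (1 - \<sigma>)\<^sup>2)"
    by (simp add: e2)
  finally show ?thesis
    by (simp add: \<sigma>_def)
qed

section \<open>The proximal map and centralized dual averaging\<close>

text \<open>\<open>arg_min_on\<close> is a choice, so these properties rest on the existence of a
  minimizer, which compactness supplies.\<close>

lemma prox_minimizes:
  fixes S :: "(real ^ 'n) set"
  assumes "compact S" "S \<noteq> {}" "continuous_on S \<psi>"
  shows prox_in: "prox S \<psi> z \<alpha> \<in> S"
    and prox_le: "y \<in> S \<Longrightarrow> z \<bullet> prox S \<psi> z \<alpha> + 1 / \<alpha> * \<psi> (prox S \<psi> z \<alpha>) \<le> z \<bullet> y + 1 / \<alpha> * \<psi> y"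
proof -
  let ?g = "\<lambda>x. z \<bullet> x + 1 / \<alpha> * \<psi> x"
  have "continuous_on S ?g"
    by (intro continuous_intros assms(3))
  from continuous_attains_inf[OF assms(1,2) this]
  obtain p where "p \<in> S" "\<And>y. y \<in> S \<Longrightarrow> ?g p \<le> ?g y"
    by blast
  then have "is_arg_min ?g (\<lambda>x. x \<in> S) p"
    by (auto simp: is_arg_min_linorder)
  then have "is_arg_min ?g (\<lambda>x. x \<in> S) (prox S \<psi> z \<alpha>)"
    unfolding prox_def arg_min_on_def arg_min_def by (rule someI)
  then show "prox S \<psi> z \<alpha> \<in> S" "y \<in> S \<Longrightarrow> ?g (prox S \<psi> z \<alpha>) \<le> ?g y"
    by (auto simp: is_arg_min_linorder)
qed

text \<open>Quadratic growth at the minimizer: the linear term adds no curvature, and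
  \<open>\<psi>\<close> scaled by \<open>1 / \<alpha>\<close> has modulus
  \<open>1 / \<alpha>\<close>. Compare \<open>p\<close> with a point on the segment to
  \<open>y\<close> and let that point tend to \<open>p\<close>.\<close>

lemma prox_strong_le:
  fixes S :: "(real ^ 'n) set" and z :: "real ^ 'n"
  assumes S: "compact S" "S \<noteq> {}" "continuous_on S \<psi>"
    and psi: "strongly_convex_on 1 S \<psi>" and \<alpha>: "\<alpha> > 0" and y: "y \<in> S"
  defines "p \<equiv> prox S \<psi> z \<alpha>"
  shows "z \<bullet> p + 1 / \<alpha> * \<psi> p + (norm (y - p))\<^sup>2 / (2 * \<alpha>) \<le> z \<bullet> y + 1 / \<alpha> * \<psi> y"
proof -
  let ?g = "\<lambda>x. z \<bullet> x + 1 / \<alpha> * \<psi> x"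
  let ?c = "(norm (y - p))\<^sup>2 / (2 * \<alpha>)"
  have p: "p \<in> S"
    unfolding p_def by (rule prox_in[OF S])
  \<comment> \<open>Dividing the comparison by \<open>t\<close> leaves the factor
    \<open>1 - t\<close>, which the limit at 0 removes.\<close>
  have *: "?g p + (1 - t) * ?c \<le> ?g y" if t: "0 < t" "t \<le> 1" for t
  proof -
    let ?w = "t *\<^sub>R y + (1 - t) *\<^sub>R p"
    have "?w \<in> S"
      using psi y p t convexD[of S y p t "1 - t"] by (auto simp: strongly_convex_on_def)
    then have "?g p \<le> ?g ?w"
      unfolding p_def by (rule prox_le[OF S])
    also have "\<dots> \<le> z \<bullet> ?w + 1 / \<alpha> * (t * \<psi> y + (1 - t) * \<psi> p - 1 / 2 * t * (1 - t) * (norm (y - p))\<^sup>2)"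
      using psi y p t \<alpha> by (intro add_left_mono mult_left_mono) (auto simp: strongly_convex_on_def)
    also have "\<dots> = t * ?g y + (1 - t) * ?g p - t * ((1 - t) * ?c)"
    proof -
      have "z \<bullet> ?w = t * (z \<bullet> y) + (1 - t) * (z \<bullet> p)"
        by (simp only: inner_add_right inner_scaleR_right)
      moreover have "t * zy + (1 - t) * zp + \<beta> * (t * a + (1 - t) * b - 1 / 2 * t * (1 - t) * n)
        = t * (zy + \<beta> * a) + (1 - t) * (zp + \<beta> * b) - t * ((1 - t) * (\<beta> * (n / 2)))"
        for zy zp \<beta> a b n :: real
        by (simp add: algebra_simps)
      moreover have "?c = 1 / \<alpha> * ((norm (y - p))\<^sup>2 / 2)"
        by simp
      ultimately show ?thesis
        by (simp only:)
    qed
    finally have "?g p \<le> t * ?g y + (1 - t) * ?g p - t * ((1 - t) * ?c)" .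
    moreover have "t * (A + B) \<le> t * A'" if "A \<le> t * A' + (1 - t) * A - t * B" for A A' B :: real
      using that by (simp add: algebra_simps)
    ultimately have "t * (?g p + (1 - t) * ?c) \<le> t * ?g y"
      by blast
    then show ?thesis
      using t by simp
  qed
  have "((\<lambda>t. ?g p + (1 - t) * ?c) \<longlongrightarrow> ?g p + (1 - 0) * ?c) (at_right 0)"
    by (intro tendsto_intros)
  moreover have "eventually (\<lambda>t. ?g p + (1 - t) * ?c \<le> ?g y) (at_right (0::real))"
    unfolding eventually_at_right_field by (intro exI[of _ 1]) (use * in auto)
  ultimately have "?g p + (1 - 0) * ?c \<le> ?g y"
    by (rule tendsto_upperbound) simp
  then show ?thesis by simp
qed

text \<open>Add the growth inequalities of the two minimizers, each tested at the other. The
  \<open>\<psi>\<close> terms cancel, and Cauchy-Schwarz finishes.\<close>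

lemma prox_lipschitz:
  fixes S :: "(real ^ 'n) set"
  assumes S: "compact S" "S \<noteq> {}" "continuous_on S \<psi>"
    and psi: "strongly_convex_on 1 S \<psi>" and \<alpha>: "\<alpha> > 0"
  shows "norm (prox S \<psi> z \<alpha> - prox S \<psi> w \<alpha>) \<le> \<alpha> * norm (z - w)"
proof -
  define p q where "p = prox S \<psi> z \<alpha>" and "q = prox S \<psi> w \<alpha>"
  have pq: "p \<in> S" "q \<in> S"
    unfolding p_def q_def by (rule prox_in[OF S])+
  have "z \<bullet> p + 1 / \<alpha> * \<psi> p + (norm (q - p))\<^sup>2 / (2 * \<alpha>) \<le> z \<bullet> q + 1 / \<alpha> * \<psi> q"
    unfolding p_def by (rule prox_strong_le[OF S psi \<alpha> pq(2)])
  moreover have "w \<bullet> q + 1 / \<alpha> * \<psi> q + (norm (p - q))\<^sup>2 / (2 * \<alpha>) \<le> w \<bullet> p + 1 / \<alpha> * \<psi> p"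
    unfolding q_def by (rule prox_strong_le[OF S psi \<alpha> pq(1)])
  ultimately have "(norm (p - q))\<^sup>2 / (2 * \<alpha>) + (norm (p - q))\<^sup>2 / (2 * \<alpha>) \<le> (z - w) \<bullet> (q - p)"
    by (simp add: inner_diff_left inner_diff_right norm_minus_commute)
  also have "\<dots> \<le> norm (z - w) * norm (p - q)"
    using norm_cauchy_schwarz[of "z - w" "q - p"] by (simp add: norm_minus_commute)
  finally have "norm (p - q) * norm (p - q) \<le> \<alpha> * norm (z - w) * norm (p - q)"
    using \<alpha> by (simp add: field_simps power2_eq_square)
  then have "norm (p - q) \<le> \<alpha> * norm (z - w)"
    using \<alpha> by (cases "norm (p - q) = 0") (auto simp: mult_le_cancel_right)
  then show ?thesis by (simp add: p_def q_def)
qed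

text \<open>The potential is the minimal regularized cumulative cost \<open>\<Phi> t\<close>. Each
  round raises it by at least the incurred cost minus a stability term, while the competitor
  \<open>y\<close> bounds its final value.\<close>

lemma dual_averaging_regret:
  fixes S :: "(real ^ 'n) set" and w :: "nat \<Rightarrow> real ^ 'n"
  assumes S: "compact S" "S \<noteq> {}" "continuous_on S \<psi>"
    and psi: "strongly_convex_on 1 S \<psi>" "\<And>y. y \<in> S \<Longrightarrow> \<psi> y \<ge> 0" and y: "y \<in> S"
  defines "q \<equiv> \<lambda>t. prox S \<psi> (\<Sum>s=1..<t. w s) (1 / sqrt (real t))"
  shows "(\<Sum>t=1..T. w t \<bullet> (q t - y)) \<le> sqrt (real T + 1) * \<psi> y + (\<Sum>t=1..T. (norm (w t))\<^sup>2 / (2 * sqrt (real t)))"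
proof -
  define \<Phi> where "\<Phi> t = (\<Sum>s=1..<t. w s) \<bullet> q t + sqrt (real t) * \<psi> (q t)" for t
  \<comment> \<open>This includes \<open>t = 0\<close>, where \<open>1 / sqrt (real t)\<close> is 0
    by convention; \<open>prox_in\<close> puts no condition on the parameter.\<close>
  have q: "q t \<in> S" for t
    unfolding q_def by (rule prox_in[OF S])
  have \<Phi>_le: "\<Phi> t + sqrt (real t) / 2 * (norm (y - q t))\<^sup>2 \<le> (\<Sum>s=1..<t. w s) \<bullet> y + sqrt (real t) * \<psi> y"
    if "t \<ge> 1" "y \<in> S" for t y
    using prox_strong_le[OF S psi(1), of "1 / sqrt (real t)" y "\<Sum>s=1..<t. w s"] that
    by (simp add: \<Phi>_def q_def mult.commute)
  have step: "\<Phi> t + w t \<bullet> q t - (norm (w t))\<^sup>2 / (2 * sqrt (real t)) \<le> \<Phi> (Suc t)" if t: "t \<ge> 1" for t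
  proof -
    let ?d = "norm (q (Suc t) - q t)" and ?s = "sqrt (real t)"
    have s: "?s > 0" using t by simp
    \<comment> \<open>Completing the square trades the growth term at \<open>q t\<close> against the
      move to \<open>q (Suc t)\<close>; this fixes the constant \<open>1 / (2 * ?s)\<close>.\<close>
    have "0 \<le> (?s * ?d - norm (w t))\<^sup>2 / (2 * ?s)"
      using s by simp
    also have "\<dots> = ?s / 2 * ?d\<^sup>2 - norm (w t) * ?d + (norm (w t))\<^sup>2 / (2 * ?s)"
      using s by (simp add: power2_diff power_mult_distrib field_simps)
    also have "\<dots> \<le> ?s / 2 * ?d\<^sup>2 + w t \<bullet> (q (Suc t) - q t) + (norm (w t))\<^sup>2 / (2 * ?s)"
      using norm_cauchy_schwarz[of "- w t" "q (Suc t) - q t"] by simp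
    finally have 1: "w t \<bullet> q t - (norm (w t))\<^sup>2 / (2 * ?s) \<le> ?s / 2 * ?d\<^sup>2 + w t \<bullet> q (Suc t)"
      by (simp add: inner_diff_right)
    \<comment> \<open>The regularization weight grows with \<open>t\<close>; nonnegativity of
      \<open>\<psi>\<close> makes this harmless.\<close>
    have "?s * \<psi> (q (Suc t)) \<le> sqrt (real (Suc t)) * \<psi> (q (Suc t))"
      by (intro mult_right_mono psi(2) q) simp
    then have 2: "(\<Sum>s=1..<t. w s) \<bullet> q (Suc t) + ?s * \<psi> (q (Suc t)) + w t \<bullet> q (Suc t) \<le> \<Phi> (Suc t)"
      using t by (simp add: \<Phi>_def inner_add_left)
    show ?thesis
      using 1 2 \<Phi>_le[OF t q[of "Suc t"]] by linarith
  qed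
  have "(\<Sum>t=1..T. w t \<bullet> q t) - (\<Sum>t=1..T. (norm (w t))\<^sup>2 / (2 * sqrt (real t))) \<le> \<Phi> (Suc T)"
  proof (induction T)
    case 0
    \<comment> \<open>The sum in \<open>\<Phi> 1\<close> is empty, so \<open>\<Phi> 1\<close> is
      \<open>\<psi> (q 1)\<close>.\<close>
    then show ?case by (simp add: \<Phi>_def psi(2) q)
  next
    case (Suc T)
    then show ?case using step[of "Suc T"] by simp
  qed
  \<comment> \<open>The weight at time \<open>Suc T\<close> is the source of
    \<open>sqrt (T + 1)\<close> in the bound; the growth term is dropped.\<close>
  also have "\<Phi> (Suc T) \<le> (\<Sum>s=1..<Suc T. w s) \<bullet> y + sqrt (real (Suc T)) * \<psi> y"
    using \<Phi>_le[of "Suc T" y] y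
    by (smt (verit) One_nat_def Suc_le_mono divide_nonneg_pos le0 mult_nonneg_nonneg of_nat_0_le_iff real_sqrt_ge_zero zero_le_power2)
  also have "(\<Sum>s=1..<Suc T. w s) \<bullet> y = (\<Sum>t=1..T. w t \<bullet> y)"
    by (simp add: inner_sum_left atLeastLessThanSuc_atLeastAtMost)
  finally show ?thesis
    by (simp add: inner_diff_right sum_subtractf add.commute)
qed

text \<open>Each term is at most twice the increment of the square root, and the increments
  telescope.\<close>

lemma sum_inverse_sqrt_le: "(\<Sum>t=1..T. 1 / sqrt (real t)) \<le> 2 * sqrt (real T)"
proof (induction T)
  case (Suc T)
  have "1 / sqrt (real (Suc T)) \<le> 2 * (sqrt (real (Suc T)) - sqrt (real T))"
  proof -
    have "0 \<le> (sqrt (real (Suc T)) - sqrt (real T))\<^sup>2" by simp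
    also have "\<dots> = 2 * real T + 1 - 2 * sqrt (real (Suc T)) * sqrt (real T)"
      by (simp add: power2_diff)
    finally have "1 \<le> 2 * (real T + 1) - 2 * (sqrt (real (Suc T)) * sqrt (real T))"
      by simp
    also have "\<dots> = 2 * (sqrt (real (Suc T)) - sqrt (real T)) * sqrt (real (Suc T))"
      by (simp add: algebra_simps)
    finally show ?thesis
      by (simp add: divide_le_eq)
  qed
  with Suc show ?case by simp
qed simp

section \<open>Gradients within a set\<close>

text \<open>The adjoint of the derivative, applied to 1, is its Riesz representative; hence the
  \<open>SOME\<close> picks a genuine gradient.\<close>

lemma has_derivative_gradient_within:
  fixes f :: "'a::euclidean_space \<Rightarrow> real"
  assumes "f differentiable_on S" "x \<in> S"
  shows "(f has_derivative (\<lambda>h. h \<bullet> gradient_within f S x)) (at x within S)"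
proof -
  obtain f' where f': "(f has_derivative f') (at x within S)"
    using assms by (auto simp: differentiable_on_def differentiable_def)
  then have "f' = (\<lambda>h. h \<bullet> adjoint f' 1)"
    by (simp add: fun_eq_iff adjoint_works has_derivative_linear)
  with f' have "\<exists>D. (f has_derivative (\<lambda>h. h \<bullet> D)) (at x within S)"
    by metis
  then show ?thesis
    unfolding gradient_within_def by (rule someI_ex)
qed

text \<open>Restricting the derivative to a segment inside \<open>S\<close> gives a one-sided limit
  that is also available at boundary points.\<close>

lemma gradient_within_tendsto:
  fixes f :: "'a::euclidean_space \<Rightarrow> real"
  assumes f: "f differentiable_on S" "x \<in> S"
    and h: "\<And>s. s \<in> {0..1} \<Longrightarrow> x + s *\<^sub>R h \<in> S"
  shows "((\<lambda>s. (f (x + s *\<^sub>R h) - f x) / s) \<longlongrightarrow> h \<bullet> gradient_within f S x) (at_right 0)"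
proof -
  let ?g = "\<lambda>s. x + s *\<^sub>R h"
  have g: "(?g has_derivative (\<lambda>s. s *\<^sub>R h)) (at 0 within {0..1})"
    by (auto intro!: derivative_eq_intros)
  have "(f has_derivative (\<lambda>h. h \<bullet> gradient_within f S x)) (at (?g 0) within ?g ` {0..1})"
    using has_derivative_gradient_within[OF f] h by (auto intro: has_derivative_subset)
  from diff_chain_within[OF g this]
  have "((\<lambda>s. f (?g s)) has_field_derivative (h \<bullet> gradient_within f S x)) (at 0 within {0..1})"
    by (simp add: has_field_derivative_def o_def mult.commute[of _ "h \<bullet> gradient_within f S x"])
  then show ?thesis
    by (simp add: has_field_derivative_iff at_within_Icc_at_right)
qed

text \<open>Convexity bounds every difference quotient towards \<open>y\<close> by
  \<open>f y - f x\<close>, and the bound survives the limit.\<close>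

lemma convex_on_gradient_within:
  fixes f :: "'a::euclidean_space \<Rightarrow> real"
  assumes f: "f differentiable_on S" "convex_on S f" and xy: "x \<in> S" "y \<in> S"
  shows "f x - f y \<le> gradient_within f S x \<bullet> (x - y)"
proof -
  have S: "x + s *\<^sub>R (y - x) = (1 - s) *\<^sub>R x + s *\<^sub>R y" for s
    by (simp add: algebra_simps)
  have "convex S"
    using f(2) convex_on_imp_convex by blast
  then have "x + s *\<^sub>R (y - x) \<in> S" if "s \<in> {0..1}" for s
    unfolding S using that xy by (intro convexD) auto
  from gradient_within_tendsto[OF f(1) xy(1) this]
  have lim: "((\<lambda>s. (f (x + s *\<^sub>R (y - x)) - f x) / s) \<longlongrightarrow> (y - x) \<bullet> gradient_within f S x) (at_right 0)"
    by blast
  have "(f (x + s *\<^sub>R (y - x)) - f x) / s \<le> f y - f x" if "0 < s" "s < 1" for s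
  proof -
    have "f (x + s *\<^sub>R (y - x)) \<le> (1 - s) * f x + s * f y"
      unfolding S using that xy by (intro convex_onD[OF f(2)]) auto
    then have "f (x + s *\<^sub>R (y - x)) - f x \<le> (f y - f x) * s"
      by (simp add: left_diff_distrib right_diff_distrib mult.commute)
    then show ?thesis
      using that by (simp add: pos_divide_le_eq)
  qed
  then have "eventually (\<lambda>s. (f (x + s *\<^sub>R (y - x)) - f x) / s \<le> f y - f x) (at_right 0)"
    unfolding eventually_at_right_field by (intro exI[of _ 1]) auto
  from tendsto_upperbound[OF lim this] show ?thesis
    by (simp add: inner_diff_left inner_diff_right inner_commute)
qed

lemma lipschitz_on_gradient_within:
  fixes f :: "'a::euclidean_space \<Rightarrow> real"
  assumes f: "f differentiable_on S" "L-lipschitz_on S f" and x: "x \<in> S"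
    and h: "\<And>s. s \<in> {0..1} \<Longrightarrow> x + s *\<^sub>R h \<in> S"
  shows "\<bar>h \<bullet> gradient_within f S x\<bar> \<le> L * norm h"
proof -
  have lim: "((\<lambda>s. \<bar>(f (x + s *\<^sub>R h) - f x) / s\<bar>) \<longlongrightarrow> \<bar>h \<bullet> gradient_within f S x\<bar>) (at_right 0)"
    by (intro tendsto_rabs gradient_within_tendsto f x h)
  have "\<bar>(f (x + s *\<^sub>R h) - f x) / s\<bar> \<le> L * norm h" if "0 < s" "s < 1" for s
    using lipschitz_onD[OF f(2) h[of s] x] that
    by (simp add: dist_norm pos_divide_le_eq mult_ac)
  then have "eventually (\<lambda>s. \<bar>(f (x + s *\<^sub>R h) - f x) / s\<bar> \<le> L * norm h) (at_right 0)"
    unfolding eventually_at_right_field by (intro exI[of _ 1]) auto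
  from tendsto_upperbound[OF lim this] show ?thesis
    by simp
qed

lemma cube_eq_cbox: "cube {a..b} = cbox (\<chi> i. a) (\<chi> i. b)"
  by (auto simp: cube_def mem_box_cart)

lemma cube_nonempty: "a \<le> b \<Longrightarrow> cube {a..b} \<noteq> {}"
  by (auto simp: cube_def intro!: exI[of _ "\<chi> i. a"])

text \<open>Boundary points need no limit argument: one of the two orientations of each axis points
  into the cube.\<close>

lemma gradient_within_cube_le:
  fixes f :: "real ^ 'n \<Rightarrow> real"
  assumes f: "f differentiable_on cube {a..b}" "L-lipschitz_on (cube {a..b}) f"
    and x: "x \<in> cube {a..b}" and ab: "a < b"
  shows "\<bar>gradient_within f (cube {a..b}) x $ k\<bar> \<le> L"
proof -
  define c where "c = (if x $ k < b then b - x $ k else a - x $ k)"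
  have xk: "a \<le> x $ i" "x $ i \<le> b" for i
    using x by (auto simp: cube_def)
  have norm_axis_c: "norm (axis k c :: real ^ 'n) = \<bar>c\<bar>"
    by (simp add: norm_eq_sqrt_inner inner_axis)
  have c: "c \<noteq> 0"
    using xk[of k] ab by (auto simp: c_def)
  have "x + axis k c \<in> cube {a..b}"
    using xk ab by (auto simp: cube_def axis_def c_def)
  moreover have "x + s *\<^sub>R axis k c = (1 - s) *\<^sub>R x + s *\<^sub>R (x + axis k c)" for s
    by (simp add: algebra_simps)
  moreover have "convex (cube {a..b} :: (real ^ 'n) set)"
    by (simp add: cube_eq_cbox)
  ultimately have "x + s *\<^sub>R axis k c \<in> cube {a..b}" if "s \<in> {0..1}" for s
    using that x by (auto intro!: convexD)
  from lipschitz_on_gradient_within[OF f x this]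
  have "\<bar>c\<bar> * \<bar>gradient_within f (cube {a..b}) x $ k\<bar> \<le> \<bar>c\<bar> * L"
    by (simp add: inner_axis' norm_axis_c abs_mult mult.commute)
  then show ?thesis
    using c by simp
qed

section \<open>One round of the network, and consensus over all coordinates\<close>

text \<open>Pass through \<open>q\<close>: Lipschitz continuity moves from the network action to
  \<open>q\<close>, convexity linearizes at \<open>q\<close>, and smoothness replaces each component
  of that gradient by the one agent \<open>i\<close> evaluates at \<open>p i\<close>.\<close>

lemma network_round_le:
  fixes g :: "real ^ 'n \<Rightarrow> real" and p :: "'n \<Rightarrow> real ^ 'n" and a b :: real
  defines "S \<equiv> cube {a..b}"
  assumes g: "convex_on S g" "L-lipschitz_on S g" "g differentiable_on S"
    and smooth: "\<And>y y'. y \<in> S \<Longrightarrow> y' \<in> S \<Longrightarrow>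
      norm (gradient_within g S y - gradient_within g S y') \<le> G * norm (y - y')"
    and G: "G \<ge> 0" and p: "\<And>i. p i \<in> S" and q: "q \<in> S" and y: "y \<in> S"
    and K: "L2_set (\<lambda>i. norm (p i - q)) UNIV \<le> K"
  shows "g (\<chi> i. p i $ i) - g y
    \<le> (\<chi> i. gradient_within g S (p i) $ i) \<bullet> (q - y) + (L + sqrt (real CARD('n)) * G * (b - a)) * K"
proof -
  let ?w = "\<chi> i. p i $ i" and ?D = "gradient_within g S"
  have box: "z \<in> S \<longleftrightarrow> (\<forall>i. a \<le> z $ i \<and> z $ i \<le> b)" for z
    by (auto simp: S_def cube_def)
  have ab: "a \<le> b"
    using q[unfolded box] by (meson order_trans)
  have w: "?w \<in> S"
    using p by (simp add: box)
  have L: "L \<ge> 0"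
    using g(2) by (rule lipschitz_on_nonneg)
  \<comment> \<open>Component \<open>i\<close> of \<open>?w - q\<close> is a single component of
    \<open>p i - q\<close>.\<close>
  have "norm (?w - q) \<le> L2_set (\<lambda>i. norm (p i - q)) UNIV"
    unfolding norm_vec_def
    by (intro L2_set_mono) (use component_le_norm_cart[of "p _ - q"] in \<open>auto simp: norm_vec_def\<close>)
  then have 1: "g ?w - g q \<le> L * K"
    using lipschitz_onD[OF g(2) w q] mult_left_mono[OF order_trans[OF _ K] L, of "norm (?w - q)"]
    by (simp add: dist_norm)
  have "(?D q - (\<chi> i. ?D (p i) $ i)) \<bullet> (q - y) \<le> (\<Sum>i\<in>UNIV. G * (b - a) * norm (p i - q))"
    unfolding inner_vec_def
  proof (intro sum_mono)
    fix i
    have "\<bar>(?D q - ?D (p i)) $ i\<bar> \<le> G * norm (p i - q)"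
      using component_le_norm_cart[of "?D q - ?D (p i)" i] smooth[OF q p[of i]]
      by (simp add: norm_minus_commute)
    moreover have "\<bar>(q - y) $ i\<bar> \<le> b - a"
      using q y by (auto simp: box abs_le_iff) (smt (verit))+
    ultimately have "\<bar>(?D q - ?D (p i)) $ i\<bar> * \<bar>(q - y) $ i\<bar> \<le> (G * norm (p i - q)) * (b - a)"
      using G by (intro mult_mono) auto
    moreover have "(?D q - (\<chi> i. ?D (p i) $ i)) $ i \<bullet> (q - y) $ i \<le> \<bar>(?D q - ?D (p i)) $ i\<bar> * \<bar>(q - y) $ i\<bar>"
      by (simp add: abs_mult[symmetric])
    ultimately show "(?D q - (\<chi> i. ?D (p i) $ i)) $ i \<bullet> (q - y) $ i \<le> G * (b - a) * norm (p i - q)"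
      by (simp add: mult_ac)
  qed
  also have "\<dots> = G * (b - a) * (\<Sum>i\<in>UNIV. \<bar>1\<bar> * \<bar>norm (p i - q)\<bar>)"
    by (simp add: sum_distrib_left)
  \<comment> \<open>Cauchy-Schwarz against the constant 1 passes from a sum of errors to their
    Euclidean norm and produces \<open>sqrt n\<close>.\<close>
  also have "\<dots> \<le> G * (b - a) * (L2_set (\<lambda>i::'n. 1) UNIV * L2_set (\<lambda>i. norm (p i - q)) UNIV)"
    using G ab by (intro mult_left_mono L2_set_mult_ineq) auto
  also have "\<dots> \<le> G * (b - a) * (sqrt (real CARD('n)) * K)"
    using G ab K by (intro mult_left_mono mult_mono) (auto simp: L2_set_def sum_nonneg)
  finally have 2: "(?D q - (\<chi> i. ?D (p i) $ i)) \<bullet> (q - y) \<le> G * (b - a) * (sqrt (real CARD('n)) * K)" .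
  show ?thesis
    using 1 2 convex_on_gradient_within[OF g(3,1) q y]
    by (simp add: inner_diff_left algebra_simps)
qed

text \<open>Sums the one-coordinate bound over all \<open>k\<close>. The bound \<open>\<rho>\<close>
  enters the squares twice, for the weights on the left and for \<open>1 / r $ k\<close> on the
  right, so the root contains \<open>1 / \<rho>\<close>.\<close>

lemma oda_consensus_le:
  fixes r :: "real ^ 'n" and M :: "real ^ 'n ^ 'n" and u :: "'n \<Rightarrow> nat \<Rightarrow> real"
    and z :: "'n \<Rightarrow> nat \<Rightarrow> real ^ 'n"
  assumes r: "\<And>i. r $ i > 0" "(\<Sum>i\<in>UNIV. r $ i) = 1"
    and M_nonneg: "\<And>i j. M $ i $ j \<ge> 0"
    and M_sym: "\<And>i j. r $ i * M $ i $ j = r $ j * M $ j $ i"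
    and M_sum: "\<And>i. (\<Sum>j\<in>UNIV. M $ i $ j) = 1"
    and gap: "spectral_gap r M > 0"
    and \<rho>: "\<rho> > 0" "\<And>i. \<rho> \<le> r $ i"
    and u: "\<And>i t. \<bar>u i t\<bar> \<le> L"
    and z: "\<And>i. z i 0 = 0"
      "\<And>i k t. z i (Suc t) $ k = 1 / r $ i * of_bool (i = k) * u i t + (\<Sum>j\<in>UNIV. M $ i $ j * z j t $ k)"
  shows "L2_set (\<lambda>i. norm (z i (Suc t) - (\<Sum>s=1..t. \<chi> k. u k s))) UNIV
    \<le> sqrt (real CARD('n)) * L / (\<rho> * (1 - sqrt (1 - spectral_gap r M)))"
proof -
  define \<sigma> where "\<sigma> = sqrt (1 - spectral_gap r M)"
  have \<sigma>: "\<sigma> < 1"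
    using spectral_gap_le_1[OF r(1) M_nonneg M_sym M_sum] gap by (auto simp: \<sigma>_def)
  have L: "L \<ge> 0"
    using u[of undefined 0] by linarith
  have r': "r $ i \<ge> 0" for i
    using r(1)[of i] by simp
  define c where "c = (\<Sum>s=1..t. \<chi> k. u k s)"
  define Z where "Z k t = (\<chi> i. z i t $ k)" for k t
  have coord: "(\<Sum>i\<in>UNIV. ((z i (Suc t) - c) $ k)\<^sup>2) \<le> L\<^sup>2 / (\<rho> * (1 - \<sigma>))\<^sup>2" for k
  proof -
    have Z: "Z k 0 = 0" "Z k (Suc t) = M *v Z k t + (u k t / r $ k) *\<^sub>R axis k 1" for t
      by (auto simp: Z_def z vec_eq_iff matrix_vector_mult_def axis_def)
    have "\<rho> * (\<Sum>i\<in>UNIV. ((z i (Suc t) - c) $ k)\<^sup>2) \<le> (\<Sum>i\<in>UNIV. r $ i * ((z i (Suc t) - c) $ k)\<^sup>2)"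
      unfolding sum_distrib_left by (intro sum_mono mult_right_mono \<rho>) simp
    also have "\<dots> = (wnorm r (Z k (Suc t) - (\<Sum>s=1..t. u k s) *\<^sub>R 1))\<^sup>2"
      unfolding wnorm_power2[OF r'] by (simp add: Z_def c_def)
    also have "\<dots> \<le> L\<^sup>2 / (r $ k * (1 - \<sigma>)\<^sup>2)"
      unfolding \<sigma>_def by (rule wnorm_consensus_le[OF r M_nonneg M_sym M_sum gap u Z])
    also have "\<dots> \<le> L\<^sup>2 / (\<rho> * (1 - \<sigma>)\<^sup>2)"
      using \<rho> \<sigma> r(1)[of k] by (intro divide_left_mono mult_right_mono mult_pos_pos) auto
    finally have "(\<Sum>i\<in>UNIV. ((z i (Suc t) - c) $ k)\<^sup>2) \<le> L\<^sup>2 / (\<rho> * (1 - \<sigma>)\<^sup>2) / \<rho>"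
      using \<rho>(1) by (simp only: pos_le_divide_eq mult.commute)
    then show ?thesis
      by (simp add: power2_eq_square mult_ac)
  qed
  have "(\<Sum>i\<in>UNIV. (norm (z i (Suc t) - c))\<^sup>2) = (\<Sum>i\<in>UNIV. \<Sum>k\<in>UNIV. ((z i (Suc t) - c) $ k)\<^sup>2)"
    by (simp add: norm_vec_def L2_set_def sum_nonneg)
  also have "\<dots> = (\<Sum>k\<in>UNIV. \<Sum>i\<in>UNIV. ((z i (Suc t) - c) $ k)\<^sup>2)"
    by (rule sum.swap)
  also have "\<dots> \<le> (\<Sum>k\<in>(UNIV::'n set). L\<^sup>2 / (\<rho> * (1 - \<sigma>))\<^sup>2)"
    by (intro sum_mono coord)
  finally have "L2_set (\<lambda>i. norm (z i (Suc t) - c)) UNIV \<le> sqrt (real CARD('n) * (L\<^sup>2 / (\<rho> * (1 - \<sigma>))\<^sup>2))"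
    by (simp add: L2_set_def)
  also have "\<dots> = sqrt (real CARD('n)) * L / (\<rho> * (1 - \<sigma>))"
    using L \<rho> \<sigma> by (simp add: real_sqrt_mult real_sqrt_divide)
  finally show ?thesis
    by (simp add: c_def \<sigma>_def)
qed

section \<open>The regret bound\<close>

theorem theorem3:
  fixes X :: "real set" and a b :: real
    and E :: "'n::finite \<Rightarrow> 'n \<Rightarrow> bool"
    and r :: "real ^ 'n" and M :: "real ^ 'n ^ 'n"
    and \<F> :: "(real ^ 'n \<Rightarrow> real) set"
    and \<psi> :: "real ^ 'n \<Rightarrow> real"
    and f :: "nat \<Rightarrow> real ^ 'n \<Rightarrow> real"
    and \<alpha> :: "nat \<Rightarrow> real"
    and u :: "'n \<Rightarrow> nat \<Rightarrow> real"
    and v :: "'n \<Rightarrow> 'n \<Rightarrow> nat \<Rightarrow> real ^ 'n"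
    and z x :: "'n \<Rightarrow> nat \<Rightarrow> real ^ 'n"
    and L G C D\<^sub>X r_min lam :: real and T :: nat
  assumes X: "a \<le> b" "X = {a..b}" "D\<^sub>X = diameter X"
    and graph: "connected_graph E"
    and r: "\<And>i. r $ i > 0" "(\<Sum>i\<in>UNIV. r $ i) = 1" "r_min = Min (range (($) r))"
    and M_nonneg: "\<And>i j. M $ i $ j \<ge> 0"
    and M_supp: "\<And>i j. M $ i $ j \<noteq> 0 \<Longrightarrow> j \<in> closed_nbhd E i"
    and M_sym: "\<And>i j. r $ i * M $ i $ j = r $ j * M $ j $ i"
    and M_sum: "\<And>i. (\<Sum>j\<in>UNIV. M $ i $ j) = 1"
    and gap: "lam = spectral_gap r M"
    and psi: "continuous_on (cube X) \<psi>" "\<And>y. y \<in> cube X \<Longrightarrow> \<psi> y \<ge> 0"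
      "strongly_convex_on 1 (cube X) \<psi>"
    and C: "C = (SUP y\<in>cube X. \<bar>\<psi> y\<bar>)"
    and F_convex: "\<And>g. g \<in> \<F> \<Longrightarrow> convex_on (cube X) g"
    and L: "L > 0"
    and F_lipschitz: "\<And>g. g \<in> \<F> \<Longrightarrow> L-lipschitz_on (cube X) g"
    and F_diff: "\<And>g. g \<in> \<F> \<Longrightarrow> g differentiable_on cube X"
    and F_smooth: "\<And>g y y'. g \<in> \<F> \<Longrightarrow> y \<in> cube X \<Longrightarrow> y' \<in> cube X \<Longrightarrow>
      norm (gradient_within g (cube X) y - gradient_within g (cube X) y') \<le> G * norm (y - y')"
    and f: "\<And>t. f t \<in> \<F>"
    and alpha: "\<And>t. \<alpha> t = 1 / sqrt (real t + 1)"
    and update: "\<And>i t. u i t = gradient_within (f t) (cube X) (x i t) \<bullet> axis i 1"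
    and messages: "\<And>i j k t. v i j t $ k = z i t $ k"
    and run: "oda_c_run (cube X) \<psi> r M \<alpha> u v z x"
    and T: "T \<ge> 1"
  shows "ereal (regret (cube X) f (network_action x) T)
    \<le> (if lam = 0 then \<infinity>
       else ereal (real CARD('n) * L\<^sup>2 *
              (1 + 2 / (r_min powr (3/2) * (1 - sqrt (1 - lam))) *
                   (1 + sqrt (real CARD('n)) * G * D\<^sub>X / L)) * sqrt (real T)
            + C * sqrt (real T + 1)))"
proof (cases "lam = 0")
  case False
  let ?S = "cube X :: (real ^ 'n) set" and ?n = "real CARD('n)" and ?\<sigma> = "sqrt (1 - lam)"
  define \<rho> where "\<rho> = r_min"
  have \<rho>: "\<rho> > 0" "\<And>i. \<rho> \<le> r $ i"
    unfolding \<rho>_def r(3) by (auto simp: r(1))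
  have \<rho>1: "\<rho> \<le> 1"
  proof -
    have "r $ undefined \<le> (\<Sum>i\<in>UNIV. r $ i)"
      by (rule member_le_sum) (auto simp: r(1) less_imp_le)
    then show ?thesis
      using \<rho>(2)[of undefined] r(2) by linarith
  qed
  have lam: "0 < lam" "lam \<le> 1"
    using spectral_gap_nonneg[OF r(1) M_nonneg M_sym M_sum]
      spectral_gap_le_1[OF r(1) M_nonneg M_sym M_sum] False by (auto simp: gap)
  then have \<sigma>: "?\<sigma> < 1"
    by auto
  have S: "compact ?S" "?S \<noteq> {}"
    unfolding X(2) using cube_nonempty[OF X(1)] by (auto simp: cube_eq_cbox)
  have psi_le: "\<psi> y \<le> C" if "y \<in> ?S" for y
  proof -
    have "bdd_above ((\<lambda>y. \<bar>\<psi> y\<bar>) ` ?S)"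
      by (intro bounded_imp_bdd_above compact_imp_bounded compact_continuous_image continuous_intros psi S)
    from cSUP_upper[OF that this] show ?thesis
      by (simp add: C)
  qed
  have DX: "D\<^sub>X = b - a"
    using X by simp
  let ?B = "?n * L\<^sup>2 * (1 + 2 / (\<rho> powr (3/2) * (1 - ?\<sigma>)) * (1 + sqrt ?n * G * D\<^sub>X / L)) * sqrt (real T)
    + C * sqrt (real T + 1)"
  \<comment> \<open>A bound uniform in the competitor \<open>y\<close> suffices, since regret
    subtracts an infimum.\<close>
  have "(\<Sum>t=1..T. f t (network_action x t)) - (\<Sum>t=1..T. f t y) \<le> ?B" if y: "y \<in> ?S" for y
  proof (cases "a = b")
    \<comment> \<open>On a one-point cube every vector is a gradient within the set, so
      \<open>u\<close> need not be bounded by \<open>L\<close>; but all actions coincide with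
      \<open>y\<close>.\<close>
    case True
    then have "w = w'" if "w \<in> ?S" "w' \<in> ?S" for w w' :: "real ^ 'n"
      using that by (simp add: X(2) cube_def vec_eq_iff)
    moreover have x_in: "x i t \<in> ?S" for i t
      using run prox_in[OF S psi(1)] by (cases t) (auto simp: oda_c_run_def)
    then have "network_action x t \<in> ?S" for t
      by (simp add: network_action_def cube_def)
    ultimately have "network_action x t = y" for t
      using y by blast
    moreover have "0 \<le> ?B"
      using L psi(2)[OF y] psi_le[OF y] True DX \<sigma> by simp
    ultimately show ?thesis
      by simp
  next
    case False
    then have ab: "a < b"
      using X(1) by simp
    \<comment> \<open>Because rows of \<open>M\<close> sum to 1, exchanging differences of dual
      vectors amounts to averaging them with \<open>M\<close>.\<close>
    have step: "z i (Suc t) $ k = 1 / r $ i * of_bool (i = k) * u i t + (\<Sum>j\<in>UNIV. M $ i $ j * z j t $ k)" for i k t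
    proof -
      have "(\<Sum>j\<in>UNIV. M $ i $ j * (z j t $ k - z i t $ k))
        = (\<Sum>j\<in>UNIV. M $ i $ j * z j t $ k) - (\<Sum>j\<in>UNIV. M $ i $ j) * z i t $ k"
        by (simp add: right_diff_distrib sum_subtractf sum_distrib_right)
      then show ?thesis
        using run by (simp add: oda_c_run_def messages M_sum)
    qed
    have z0: "z i 0 = 0" for i
      using run by (simp add: oda_c_run_def)
    \<comment> \<open>The parameter used for \<open>x i t\<close> is
      \<open>\<alpha> (t - 1) = 1 / sqrt t\<close>, matching that of \<open>q t\<close>.\<close>
    have x_Suc: "x i (Suc t) = prox ?S \<psi> (z i (Suc t)) (1 / sqrt (real (Suc t)))" for i t
      using run by (simp add: oda_c_run_def alpha add.commute)
    have x_in: "x i t \<in> ?S" for i t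
      using run prox_in[OF S psi(1)] by (cases t) (auto simp: oda_c_run_def)
    have u_eq: "u i t = gradient_within (f t) ?S (x i t) $ i" for i t
      by (simp add: update inner_axis)
    have u_le: "\<bar>u i t\<bar> \<le> L" for i t
      unfolding u_eq using F_diff[OF f] F_lipschitz[OF f] x_in ab
      by (auto simp: X(2) intro!: gradient_within_cube_le)
    obtain y1 y2 :: "real ^ 'n" where y12: "y1 \<in> ?S" "y2 \<in> ?S" "y1 \<noteq> y2"
    proof
      show "(\<chi> i. a) \<in> ?S" "(\<chi> i. b) \<in> ?S" "(\<chi> i. a) \<noteq> ((\<chi> i. b) :: real ^ 'n)"
        using ab by (auto simp: X(2) cube_def vec_eq_iff)
    qed
    \<comment> \<open>Two distinct points in the smoothness condition exclude a negative
      constant.\<close>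
    have G: "G \<ge> 0"
      using order_trans[OF norm_ge_zero F_smooth[OF f y12(1,2), of 0]] y12(3)
      by (simp add: zero_le_mult_iff)
    define w where "w t = (\<chi> i. u i t)" for t
    define q where "q t = prox ?S \<psi> (\<Sum>s=1..<t. w s) (1 / sqrt (real t))" for t
    define K where "K = sqrt ?n * L / (\<rho> * (1 - ?\<sigma>))"
    have K: "K \<ge> 0"
      using L \<rho> \<sigma> by (simp add: K_def)
    have q: "q t \<in> ?S" for t
      unfolding q_def by (rule prox_in[OF S psi(1)])
    let ?A = "L + sqrt ?n * G * (b - a)"
    have A: "?A \<ge> 0"
      using L G ab by simp
    have round: "f t (network_action x t) - f t y \<le> w t \<bullet> (q t - y) + ?A * K * (1 / sqrt (real t))"
      if "t \<in> {1..T}" for t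
    proof -
      \<comment> \<open>Costs start at round 1, where \<open>x i t\<close> is already a proximal
        point; \<open>x i 0\<close> is an arbitrary point of the cube.\<close>
      obtain t' where t': "t = Suc t'"
        using \<open>t \<in> {1..T}\<close> by (cases t) auto
      have "L2_set (\<lambda>i. norm (x i t - q t)) UNIV
        \<le> L2_set (\<lambda>i. 1 / sqrt (real t) * norm (z i t - (\<Sum>s=1..<t. w s))) UNIV"
        unfolding t' x_Suc q_def
        by (intro L2_set_mono prox_lipschitz[OF S psi(1,3)]) auto
      also have "\<dots> = 1 / sqrt (real t) * L2_set (\<lambda>i. norm (z i t - (\<Sum>s=1..<t. w s))) UNIV"
        by (rule L2_set_right_distrib[symmetric]) simp
      also have "\<dots> \<le> 1 / sqrt (real t) * K"
        unfolding t' K_def w_def atLeastLessThanSuc_atLeastAtMost gap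
        using oda_consensus_le[OF r(1,2) M_nonneg M_sym M_sum _ \<rho> u_le z0 step] lam
        by (intro mult_left_mono) (auto simp: gap)
      finally have "f t (\<chi> i. x i t $ i) - f t y
        \<le> (\<chi> i. gradient_within (f t) ?S (x i t) $ i) \<bullet> (q t - y) + ?A * (1 / sqrt (real t) * K)"
        unfolding X(2) using F_convex[OF f] F_lipschitz[OF f] F_diff[OF f] F_smooth[OF f] G x_in q y
        by (intro network_round_le) (auto simp: X(2))
      then show ?thesis
        by (simp add: network_action_def w_def u_eq mult_ac)
    qed
    have w_le: "(norm (w t))\<^sup>2 / (2 * sqrt (real t)) \<le> ?n * L\<^sup>2 / 2 * (1 / sqrt (real t))" for t
    proof -
      have "(norm (w t))\<^sup>2 = (\<Sum>i\<in>UNIV. \<bar>u i t\<bar>\<^sup>2)"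
        by (simp add: w_def norm_vec_def L2_set_def sum_nonneg)
      also have "\<dots> \<le> (\<Sum>i\<in>(UNIV :: 'n set). L\<^sup>2)"
        by (intro sum_mono power_mono u_le) simp
      finally have "(norm (w t))\<^sup>2 * (1 / (2 * sqrt (real t))) \<le> (?n * L\<^sup>2) * (1 / (2 * sqrt (real t)))"
        by (intro mult_right_mono) auto
      then show ?thesis
        by simp
    qed
    have "(\<Sum>t=1..T. f t (network_action x t)) - (\<Sum>t=1..T. f t y)
      \<le> (\<Sum>t=1..T. w t \<bullet> (q t - y)) + ?A * K * (\<Sum>t=1..T. 1 / sqrt (real t))"
      unfolding sum_subtractf[symmetric] sum_distrib_left sum.distrib[symmetric]
      by (rule sum_mono) (rule round)
    also have "(\<Sum>t=1..T. w t \<bullet> (q t - y))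
      \<le> sqrt (real T + 1) * \<psi> y + (\<Sum>t=1..T. (norm (w t))\<^sup>2 / (2 * sqrt (real t)))"
      unfolding q_def by (rule dual_averaging_regret[OF S psi(1,3,2) y])
    also have "(\<Sum>t=1..T. (norm (w t))\<^sup>2 / (2 * sqrt (real t))) \<le> ?n * L\<^sup>2 / 2 * (\<Sum>t=1..T. 1 / sqrt (real t))"
      unfolding sum_distrib_left by (rule sum_mono) (rule w_le)
    also have "sqrt (real T + 1) * \<psi> y \<le> sqrt (real T + 1) * C"
      by (intro mult_left_mono psi_le y) simp
    also have "?n * L\<^sup>2 / 2 * (\<Sum>t=1..T. 1 / sqrt (real t)) \<le> ?n * L\<^sup>2 / 2 * (2 * sqrt (real T))"
      by (intro mult_left_mono sum_inverse_sqrt_le) auto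
    also have "?A * K * (\<Sum>t=1..T. 1 / sqrt (real t)) \<le> ?A * K * (2 * sqrt (real T))"
      by (intro mult_left_mono sum_inverse_sqrt_le mult_nonneg_nonneg A K)
    \<comment> \<open>The argument yields the sharper \<open>sqrt n / \<rho>\<close>; it is weakened
      to the stated form by \<open>sqrt n \<le> n\<close> and by \<open>\<rho> \<le> 1\<close>,
      which holds because the weights sum to 1.\<close>
    also have "?A * K * (2 * sqrt (real T)) \<le> ?A * (?n * L / (\<rho> powr (3/2) * (1 - ?\<sigma>))) * (2 * sqrt (real T))"
    proof -
      have "sqrt ?n \<le> ?n"
        by (rule real_le_lsqrt) (auto simp: power2_eq_square)
      moreover have "\<rho> powr (3/2) \<le> \<rho>"
        using powr_mono'[of 1 "3/2" \<rho>] \<rho>(1) \<rho>1 by simp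
      ultimately have "K \<le> ?n * L / (\<rho> powr (3/2) * (1 - ?\<sigma>))"
        unfolding K_def using L \<rho>(1) \<sigma>
        by (intro frac_le mult_right_mono mult_pos_pos) auto
      then show ?thesis
        by (intro mult_right_mono mult_left_mono A) auto
    qed
    also have "sqrt (real T + 1) * C + ?n * L\<^sup>2 / 2 * (2 * sqrt (real T))
      + ?A * (?n * L / (\<rho> powr (3/2) * (1 - ?\<sigma>))) * (2 * sqrt (real T)) = ?B"
    proof -
      have "?A = L * (1 + sqrt ?n * G * D\<^sub>X / L)"
        using L by (simp add: DX distrib_left)
      moreover have "s' * C + ?n * L\<^sup>2 / 2 * (2 * s) + L * E * (?n * L / R) * (2 * s)
        = ?n * L\<^sup>2 * (1 + 2 / R * E) * s + C * s'" for s s' E R :: real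
        by (simp add: power2_eq_square algebra_simps)
      ultimately show ?thesis
        by (simp only:)
    qed
    finally show ?thesis
      by simp
  qed
  then have "(\<Sum>t=1..T. f t (network_action x t)) - ?B \<le> (INF y\<in>?S. \<Sum>t=1..T. f t y)"
    using S(2) by (intro cINF_greatest) (auto simp: algebra_simps)
  then have "regret ?S f (network_action x) T \<le> ?B"
    by (simp add: regret_def)
  then show ?thesis
    using False by (simp add: \<rho>_def)
qed simp

end
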